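(* Let $A\in\mathbb{R}^{n\times n}$ be symmetric positive definite, let $B\in\mathbb{R}^{m\times n}$ with $\operatorname{rank}(B)=m<n$, let $\alpha>0$, let $b\in\mathbb{R}^{n+m}$, and let $$\mathcal{A}=\begin{bmatrix}A & B^T\\ -B & 0\end{bmatrix},\qquad \mathcal{P}_{REHSS}=\begin{bmatrix}A & AB^T\\ -B & \alpha I\end{bmatrix}.$$ Then the degree of the minimal polynomial of the preconditioned matrix $\mathcal{P}_{REHSS}^{-1}\mathcal{A}$ is at most $m+1$. Thus, the dimension of the Krylov subspace $\mathcal{K}_n(\mathcal{P}_{REHSS}^{-1}\mathcal{A},b)$ is at most $m+1$.
   Context: For a square real matrix $M$ of order $N$, a vector $r\in\mathbb{R}^N$ and a positive integer $k$, the Krylov subspace is $\mathcal{K}_k(M,r)=\operatorname{span}\{r,Mr,\ldots,M^{k-1}r\}$. $I$ denotes the identity matrix of the appropriate size. The matrix $\mathcal{P}_{REHSS}$ (the REHSS preconditioner) is invertible for every $\alpha>0$. *)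

theory Defs
  imports "HOL-Analysis.Analysis" "HOL-Computational_Algebra.Polynomial"
begin

definition symmetric_positive_definite :: "real^'n^'n \<Rightarrow> bool" where
  "symmetric_positive_definite A \<longleftrightarrow>
     transpose A = A \<and> (\<forall>x. x \<noteq> 0 \<longrightarrow> x \<bullet> (A *v x) > 0)"

(* The block matrix [[P, Q], [R, S]]; rows and columns of type 'n + 'm carry
   the indices of the first block as Inl and those of the second as Inr. *)
definition block_matrix ::
  "real^'n^'n \<Rightarrow> real^'m^'n \<Rightarrow> real^'n^'m \<Rightarrow> real^'m^'m \<Rightarrow> real^('n + 'm)^('n + 'm)" where
  "block_matrix P Q R S = (\<chi> i j.
     case i of
       Inl a \<Rightarrow> (case j of Inl c \<Rightarrow> P $ a $ c | Inr d \<Rightarrow> Q $ a $ d)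
     | Inr b \<Rightarrow> (case j of Inl c \<Rightarrow> R $ b $ c | Inr d \<Rightarrow> S $ b $ d))"

definition saddle_matrix :: "real^'n^'n \<Rightarrow> real^'n^'m \<Rightarrow> real^('n + 'm)^('n + 'm)" where
  "saddle_matrix A B = block_matrix A (transpose B) (- B) 0"

definition rehss :: "real \<Rightarrow> real^'n^'n \<Rightarrow> real^'n^'m \<Rightarrow> real^('n + 'm)^('n + 'm)" where
  "rehss \<alpha> A B = block_matrix A (A ** transpose B) (- B) (mat \<alpha>)"

(* The overloaded power and product on vectors are componentwise, hence a separate power. *)
primrec matpow :: "real^'n^'n \<Rightarrow> nat \<Rightarrow> real^'n^'n" where
  "matpow M 0 = mat 1"
| "matpow M (Suc k) = M ** matpow M k"

definition poly_matrix :: "real poly \<Rightarrow> real^'n^'n \<Rightarrow> real^'n^'n" where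
  "poly_matrix p M = (\<Sum>i\<le>degree p. coeff p i *\<^sub>R matpow M i)"

definition is_minimal_poly :: "real^'n^'n \<Rightarrow> real poly \<Rightarrow> bool" where
  "is_minimal_poly M p \<longleftrightarrow>
     lead_coeff p = 1 \<and> poly_matrix p M = 0 \<and>
     (\<forall>q. q \<noteq> 0 \<and> poly_matrix q M = 0 \<longrightarrow> degree p \<le> degree q)"

definition minimal_poly :: "real^'n^'n \<Rightarrow> real poly" where
  "minimal_poly M = (THE p. is_minimal_poly M p)"

definition krylov :: "nat \<Rightarrow> real^'n^'n \<Rightarrow> real^'n \<Rightarrow> (real^'n) set" where
  "krylov k M r = span ((\<lambda>j. matpow M j *v r) ` {..<k})"

lemma poly_matrix_altdef:
  assumes "degree p \<le> N"
  shows "poly_matrix p M = (\<Sum>i\<le>N. coeff p i *\<^sub>R matpow M i)"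
  unfolding poly_matrix_def
  by (rule sum.mono_neutral_left) (use assms in \<open>auto simp: coeff_eq_0\<close>)

lemma poly_matrix_diff: "poly_matrix (p - q) M = poly_matrix p M - poly_matrix q M"
proof -
  let ?N = "max (degree p) (degree q)"
  have "poly_matrix (p - q) M = (\<Sum>i\<le>?N. coeff (p - q) i *\<^sub>R matpow M i)"
    by (rule poly_matrix_altdef) (rule degree_diff_le_max)
  then show ?thesis
    by (simp add: poly_matrix_altdef[of p ?N] poly_matrix_altdef[of q ?N]
        scaleR_diff_left sum_subtractf)
qed

lemma poly_matrix_smult: "poly_matrix (smult c p) M = c *\<^sub>R poly_matrix p M"
  by (simp add: poly_matrix_altdef[of "smult c p" "degree p"] poly_matrix_def scaleR_sum_right
      degree_smult_le)

lemma ex_annihilating_poly: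
  fixes M :: "real^'n^'n"
  shows "\<exists>p. p \<noteq> 0 \<and> poly_matrix p M = 0"
proof -
  define N where "N = DIM(real^'n^'n)"
  have "\<exists>c. (\<exists>i\<le>N. c i \<noteq> 0) \<and> (\<Sum>i\<le>N. c i *\<^sub>R matpow M i) = 0"
  proof (cases "inj_on (matpow M) {..N}")
    case True
    then have "card (matpow M ` {..N}) = Suc N"
      by (simp only: card_image card_atMost)
    then have "dependent (matpow M ` {..N})"
      using independent_bound[of "matpow M ` {..N}"] unfolding N_def[symmetric] by linarith
    then obtain u where u: "\<exists>v\<in>matpow M ` {..N}. u v \<noteq> 0"
      "(\<Sum>v\<in>matpow M ` {..N}. u v *\<^sub>R v) = 0"
      using dependent_finite[of "matpow M ` {..N}"] by blast
    have "(\<Sum>i\<le>N. u (matpow M i) *\<^sub>R matpow M i) = 0"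
      using u(2) by (simp only: sum.reindex[OF True] o_def)
    moreover have "\<exists>i\<le>N. u (matpow M i) \<noteq> 0"
      using u(1) by blast
    ultimately show ?thesis by (intro exI[of _ "\<lambda>i. u (matpow M i)"] conjI)
  next
    case False
    then obtain i j where ij: "i \<le> N" "j \<le> N" "i \<noteq> j" "matpow M i = matpow M j"
      unfolding inj_on_def by blast
    let ?c = "\<lambda>k. (if k = i then 1 else 0) - (if k = j then 1 else 0 :: real)"
    have "?c k *\<^sub>R matpow M k =
        (if k = i then matpow M k else 0) - (if k = j then matpow M k else 0)" for k
      by auto
    then have "(\<Sum>k\<le>N. ?c k *\<^sub>R matpow M k) = matpow M i - matpow M j"
      using ij(1,2) by (simp only: sum_subtractf sum.delta finite_atMost atMost_iff if_True)
    then show ?thesis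
      using ij by (intro exI[of _ ?c] conjI exI[of _ i]) auto
  qed
  then obtain c i where c: "i \<le> N" "c i \<noteq> 0" "(\<Sum>i\<le>N. c i *\<^sub>R matpow M i) = 0"
    by blast
  define p where "p = (\<Sum>k\<le>N. monom (c k) k)"
  have cf: "coeff p k = (if k \<le> N then c k else 0)" for k
    unfolding p_def by (simp add: coeff_sum)
  have "degree p \<le> N"
    by (rule degree_le) (use cf in auto)
  then have "poly_matrix p M = (\<Sum>k\<le>N. coeff p k *\<^sub>R matpow M k)"
    by (rule poly_matrix_altdef)
  also have "\<dots> = 0"
    unfolding c(3)[symmetric] by (rule sum.cong) (use cf in auto)
  finally have "poly_matrix p M = 0" .
  moreover have "coeff p i \<noteq> 0"
    using c cf by presburger
  ultimately show ?thesis
    by (intro exI[of _ p]) auto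
qed

lemma ex1_minimal_poly: "\<exists>!p. is_minimal_poly M p"
proof (rule ex_ex1I)
  obtain p where p: "p \<noteq> 0 \<and> poly_matrix p M = 0"
    and least: "\<forall>q. degree q < degree p \<longrightarrow> \<not> (q \<noteq> 0 \<and> poly_matrix q M = 0)"
    using exists_least_iff[of "\<lambda>d. \<exists>p. p \<noteq> 0 \<and> poly_matrix p M = 0 \<and> degree p = d"]
      ex_annihilating_poly[of M] by blast
  have "is_minimal_poly M (smult (inverse (lead_coeff p)) p)"
    using p least unfolding is_minimal_poly_def
    by (auto simp: poly_matrix_smult not_less[symmetric])
  then show "\<exists>p. is_minimal_poly M p" ..
next
  fix p q assume p: "is_minimal_poly M p" and q: "is_minimal_poly M q"
  have "p \<noteq> 0" "q \<noteq> 0"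
    using p q unfolding is_minimal_poly_def by auto
  then have deg: "degree p = degree q"
    using p q unfolding is_minimal_poly_def by (meson antisym)
  show "p = q"
  proof (rule ccontr)
    assume "p \<noteq> q"
    have ann: "poly_matrix (p - q) M = 0"
      using p q by (simp add: poly_matrix_diff is_minimal_poly_def)
    then have "degree p \<le> degree (p - q)"
      using p \<open>p \<noteq> q\<close> by (simp add: is_minimal_poly_def)
    moreover have "degree (p - q) \<le> degree p"
      using degree_diff_le_max[of p q] deg by simp
    ultimately have "lead_coeff (p - q) = coeff p (degree p) - coeff q (degree q)"
      using deg by simp
    then have "lead_coeff (p - q) = 0"
      using p q by (simp add: is_minimal_poly_def)
    then have "p - q = 0" by (rule leading_coeff_0_iff[THEN iffD1])
    then show False using \<open>p \<noteq> q\<close> by simp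
  qed
qed

lemma minimal_poly_is_minimal: "is_minimal_poly M (minimal_poly M)"
  unfolding minimal_poly_def by (rule theI'[OF ex1_minimal_poly])

lemma sum_UNIV_sum:
  "(\<Sum>i\<in>(UNIV :: ('n::finite + 'm::finite) set). f i) =
     (\<Sum>a\<in>UNIV. f (Inl a)) + (\<Sum>b\<in>UNIV. f (Inr b))"
  by (simp only: UNIV_Plus_UNIV[symmetric] sum.Plus finite o_def)

lemma block_matrix_mult_Inl:
  "(block_matrix P Q R S *v z) $ Inl a =
     (P *v (\<chi> c. z $ Inl c)) $ a + (Q *v (\<chi> d. z $ Inr d)) $ a"
  by (simp add: block_matrix_def matrix_vector_mult_def sum_UNIV_sum)

lemma block_matrix_mult_Inr:
  "(block_matrix P Q R S *v z) $ Inr b =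
     (R *v (\<chi> c. z $ Inl c)) $ b + (S *v (\<chi> d. z $ Inr d)) $ b"
  by (simp add: block_matrix_def matrix_vector_mult_def sum_UNIV_sum)

lemma invertible_rehss:
  fixes A :: "real^'n^'n" and B :: "real^'n^'m"
  assumes spd: "symmetric_positive_definite A" and "\<alpha> > 0"
  shows "invertible (rehss \<alpha> A B)"
proof -
  have "z = 0" if z: "rehss \<alpha> A B *v z = 0" for z
  proof -
    define x where "x = (\<chi> c. z $ Inl c)"
    define y where "y = (\<chi> d. z $ Inr d)"
    have "A *v x + (A ** transpose B) *v y = 0"
      unfolding vec_eq_iff x_def y_def vector_add_component
      using z[unfolded rehss_def] block_matrix_mult_Inl[where z = z]
      by (metis zero_index)
    then have "A *v (x + transpose B *v y) = 0"
      by (simp only: matrix_vector_right_distrib matrix_vector_mul_assoc)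
    then have xy: "x + transpose B *v y = 0"
      using spd unfolding symmetric_positive_definite_def by (metis inner_zero_right less_irrefl)
    have "(- B) *v x + mat \<alpha> *v y = 0"
      unfolding vec_eq_iff x_def y_def vector_add_component
      using z[unfolded rehss_def] block_matrix_mult_Inr[where z = z]
      by (metis zero_index)
    moreover have "mat \<alpha> *v y = \<alpha> *\<^sub>R y"
      by (simp add: vec_eq_iff matrix_vector_mult_def mat_def if_distrib[of "\<lambda>x. x * _"] cong: if_cong)
    moreover have "(- B) *v x = - (B *v x)"
      by (simp add: vec_eq_iff matrix_vector_mult_def sum_negf)
    ultimately have "B *v x = \<alpha> *\<^sub>R y" by simp
    then have "y \<bullet> (B *v x) = \<alpha> * (y \<bullet> y)" by simp
    moreover have "y \<bullet> (B *v x) = (transpose B *v y) \<bullet> x"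
      by (simp add: dot_lmul_matrix)
    moreover have "x = - (transpose B *v y)"
      using xy by (simp add: eq_neg_iff_add_eq_0)
    ultimately have "\<alpha> * (y \<bullet> y) + (transpose B *v y) \<bullet> (transpose B *v y) = 0"
      by simp
    moreover have "\<alpha> * (y \<bullet> y) \<ge> 0" using \<open>\<alpha> > 0\<close> by simp
    ultimately have "\<alpha> * (y \<bullet> y) = 0"
      by (smt (verit) inner_ge_zero)
    then have "y = 0" using \<open>\<alpha> > 0\<close> by simp
    moreover from this have "x = 0"
      using xy by simp
    ultimately have "z $ i = 0" for i
      by (cases i) (auto simp: x_def y_def vec_eq_iff)
    then show ?thesis by (simp add: vec_eq_iff)
  qed
  then show ?thesis
    unfolding invertible_left_inverse matrix_left_invertible_ker by blast
qed

end

theory Submission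
  imports Defs
begin

text \<open>
  Write \<open>P\<close> for the preconditioner, \<open>S\<close> for the saddle point matrix, and \<open>T = P\<^sup>-\<^sup>1 S\<close>. The matrices
  \<open>P\<close> and \<open>S\<close> have the same first block column, so \<open>S - P\<close>, and with it
  \<open>T - I = P\<^sup>-\<^sup>1 (S - P)\<close>, has rank at most \<open>m\<close> (\<open>rank_saddle_minus_rehss_le\<close>). In other words, \<open>T\<close>
  is a perturbation of the identity of rank at most \<open>m\<close>.

  The range \<open>W\<close> of \<open>T - I\<close> is invariant under \<open>T\<close> and has dimension at most \<open>m\<close>. On an
  invariant subspace \<open>W\<close> some nonzero polynomial \<open>p\<close> of degree at most \<open>dim W\<close> in \<open>T\<close> vanishes
  (\<open>annihilator_of_invariant_subspace\<close>); this is the degree bound that the Cayley-Hamilton theorem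
  gives, obtained here without determinants by splitting off one cyclic subspace at a time. Then
  \<open>p(T) (T - I) = 0\<close>, so \<open>p(x) (x - 1)\<close> annihilates \<open>T\<close> and has degree at most \<open>m + 1\<close>. This bounds the degree of the minimal polynomial. It bounds
  the dimension of every Krylov subspace as well: division with remainder by an annihilating
  polynomial of degree \<open>d\<close> expresses all powers of \<open>T\<close> by the first \<open>d\<close> of them
  (\<open>krylov_subset_of_annihilator\<close>).
\<close>

section \<open>Polynomials of a matrix\<close>

lemma poly_matrix_0 [simp]: "poly_matrix 0 M = 0"
  by (simp add: poly_matrix_def)

lemma matrix_mult_sum_right:
  fixes M :: "real^'n^'m" and f :: "'i \<Rightarrow> real^'p^'n"
  shows "M ** (\<Sum>i\<in>I. f i) = (\<Sum>i\<in>I. M ** f i)"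
  by (induction I rule: infinite_finite_induct) (auto simp: matrix_add_ldistrib)

lemma matrix_add_rdistrib:
  fixes A B :: "real^'n^'m" and C :: "real^'p^'n"
  shows "(A + B) ** C = A ** C + B ** C"
  by (simp add: matrix_eq matrix_vector_mult_add_rdistrib flip: matrix_vector_mul_assoc)

lemma matrix_vector_mult_sum:
  fixes f :: "'i \<Rightarrow> real^'n^'m"
  shows "(\<Sum>i\<in>I. f i) *v x = (\<Sum>i\<in>I. f i *v x)"
  by (induction I rule: infinite_finite_induct) (auto simp: matrix_vector_mult_add_rdistrib)

lemma matrix_inv_left:
  fixes A :: "real^'n^'n"
  assumes "invertible A"
  shows "matrix_inv A ** A = mat 1"
  using someI_ex[OF assms[unfolded invertible_def]] unfolding matrix_inv_def by blast

lemma poly_matrix_pCons: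
  "poly_matrix (pCons a p) M = a *\<^sub>R mat 1 + M ** poly_matrix p M"
proof -
  have "poly_matrix (pCons a p) M
      = (\<Sum>i\<le>Suc (degree p). coeff (pCons a p) i *\<^sub>R matpow M i)"
    by (rule poly_matrix_altdef) (rule degree_pCons_le)
  also have "\<dots> = a *\<^sub>R mat 1 + (\<Sum>i\<le>degree p. M ** (coeff p i *\<^sub>R matpow M i))"
    by (subst sum.atMost_Suc_shift) (simp add: matrix_scalar_ac scalar_matrix_assoc)
  finally show ?thesis
    by (simp add: poly_matrix_def matrix_mult_sum_right)
qed

lemma poly_matrix_add: "poly_matrix (p + q) M = poly_matrix p M + poly_matrix q M"
  using poly_matrix_diff[of p "- q" M] poly_matrix_diff[of 0 q M] by simp

lemma poly_matrix_mult: "poly_matrix (p * q) M = poly_matrix p M ** poly_matrix q M"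
proof (induction p)
  case (pCons a p)
  then show ?case
    by (simp add: poly_matrix_pCons poly_matrix_add poly_matrix_smult matrix_add_rdistrib
        matrix_mul_assoc scalar_matrix_assoc[symmetric])
qed simp

lemma poly_matrix_X [simp]: "poly_matrix [:0, 1:] M = M"
  by (simp add: poly_matrix_pCons)

lemma poly_matrix_commute: "M ** poly_matrix p M = poly_matrix p M ** M"
  using poly_matrix_mult[of "[:0, 1:]" p M] poly_matrix_mult[of p "[:0, 1:]" M]
  by (simp add: mult.commute)

lemma poly_matrix_monom: "poly_matrix (monom c k) M = c *\<^sub>R matpow M k"
proof (induction k)
  case (Suc k)
  then show ?case
    by (simp add: monom_Suc poly_matrix_pCons matrix_scalar_ac scalar_matrix_assoc)
qed (simp add: monom_0 poly_matrix_pCons)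

section \<open>Krylov subspaces and annihilating polynomials\<close>

lemma dim_krylov_le: "dim (krylov k M r) \<le> k"
proof -
  have "dim (krylov k M r) \<le> card ((\<lambda>j. matpow M j *v r) ` {..<k})"
    unfolding krylov_def dim_span by (rule dim_le_card') simp
  also have "\<dots> \<le> k"
    using card_image_le[of "{..<k}"] by simp
  finally show ?thesis .
qed

text \<open>
  This description turns questions about Krylov subspaces into polynomial arithmetic. The
  condition on the coefficients says that the degree is below \<open>k\<close>, in a form that is stable under
  addition and is also right for \<open>p = 0\<close> and \<open>k = 0\<close>.
\<close>

lemma krylov_eq_polys:
  "krylov k M r = {poly_matrix p M *v r | p. \<forall>i\<ge>k. coeff p i = 0}" (is "_ = ?R")
proof
  have "subspace ?R"
  proof (rule subspaceI)
    show "0 \<in> ?R"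
      by (auto intro!: exI[of _ 0])
    show "x + y \<in> ?R" if "x \<in> ?R" "y \<in> ?R" for x y
    proof -
      from that obtain p q where "x = poly_matrix p M *v r" "\<forall>i\<ge>k. coeff p i = 0"
        "y = poly_matrix q M *v r" "\<forall>i\<ge>k. coeff q i = 0" by blast
      then show ?thesis
        by (auto intro!: exI[of _ "p + q"] simp: poly_matrix_add matrix_vector_mult_add_rdistrib)
    qed
    show "c *\<^sub>R x \<in> ?R" if "x \<in> ?R" for c x
    proof -
      from that obtain p where "x = poly_matrix p M *v r" "\<forall>i\<ge>k. coeff p i = 0"
        by blast
      then show ?thesis
        by (auto intro!: exI[of _ "smult c p"]
            simp: poly_matrix_smult scaleR_matrix_vector_assoc)
    qed
  qed
  moreover have "(\<lambda>j. matpow M j *v r) ` {..<k} \<subseteq> ?R"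
  proof clarify
    fix j assume "j < k"
    then show "\<exists>p. matpow M j *v r = poly_matrix p M *v r \<and> (\<forall>i\<ge>k. coeff p i = 0)"
      by (intro exI[of _ "monom 1 j"]) (simp add: poly_matrix_monom)
  qed
  ultimately show "krylov k M r \<subseteq> ?R"
    unfolding krylov_def by (rule span_minimal[rotated])
next
  show "?R \<subseteq> krylov k M r"
  proof clarify
    fix p :: "real poly" assume p: "\<forall>i\<ge>k. coeff p i = 0"
    have "poly_matrix p M *v r = (\<Sum>i\<le>degree p. coeff p i *\<^sub>R (matpow M i *v r))"
      unfolding poly_matrix_def
      by (simp add: matrix_vector_mult_sum scaleR_matrix_vector_assoc)
    also have "\<dots> \<in> krylov k M r"
      unfolding krylov_def
    proof (rule span_sum)
      fix i
      show "coeff p i *\<^sub>R (matpow M i *v r) \<in> span ((\<lambda>j. matpow M j *v r) ` {..<k})"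
      proof (cases "i < k")
        case True
        then show ?thesis by (intro span_scale span_base) auto
      next
        case False
        then show ?thesis using p by (simp add: span_zero)
      qed
    qed
    finally show "poly_matrix p M *v r \<in> krylov k M r" .
  qed
qed

text \<open>
  Modulo the annihilator \<open>q\<close>, every polynomial acts on \<open>r\<close> as its remainder does, and the remainder
  has degree below that of \<open>q\<close>.
\<close>

lemma krylov_subset_of_annihilator:
  assumes "q \<noteq> 0" and "poly_matrix q M *v r = 0"
  shows "krylov k M r \<subseteq> krylov (degree q) M r"
proof
  fix x assume "x \<in> krylov k M r"
  then obtain p where p: "x = poly_matrix p M *v r"
    unfolding krylov_eq_polys by blast
  have "poly_matrix p M = poly_matrix (p div q) M ** poly_matrix q M + poly_matrix (p mod q) M"
    by (simp flip: poly_matrix_mult poly_matrix_add)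
  then have "x = poly_matrix (p mod q) M *v r"
    using assms p by (simp add: matrix_vector_mult_add_rdistrib flip: matrix_vector_mul_assoc)
  moreover have "\<forall>i\<ge>degree q. coeff (p mod q) i = 0"
    using degree_mod_less[OF \<open>q \<noteq> 0\<close>, of p] by (auto intro: coeff_eq_0)
  ultimately show "x \<in> krylov (degree q) M r"
    unfolding krylov_eq_polys by blast
qed

text \<open>
  Below the least degree of an annihilator of \<open>r\<close> the iterates are linearly independent: if the
  \<open>j\<close>-th one were a combination of its predecessors, that relation would be an annihilator of
  degree \<open>j\<close>.
\<close>

lemma dim_krylov_eq_degree:
  assumes least: "\<And>p. p \<noteq> 0 \<Longrightarrow> poly_matrix p M *v r = 0 \<Longrightarrow> d \<le> degree p"
  shows "dim (krylov d M r) = d"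
proof -
  have "dim (krylov j M r) = j" if "j \<le> d" for j
    using that
  proof (induction j)
    case (Suc j)
    have "matpow M j *v r \<notin> krylov j M r"
    proof
      assume "matpow M j *v r \<in> krylov j M r"
      then obtain p where p: "matpow M j *v r = poly_matrix p M *v r" "\<forall>i\<ge>j. coeff p i = 0"
        unfolding krylov_eq_polys by blast
      let ?q = "monom 1 j - p"
      have "coeff ?q j = 1"
        using p(2) by simp
      then have "?q \<noteq> 0" by fastforce
      moreover have "poly_matrix ?q M *v r = 0"
        using p(1) by (simp add: poly_matrix_diff poly_matrix_monom matrix_vector_mult_diff_rdistrib)
      moreover have "degree ?q \<le> j"
        using p(2) by (intro degree_le) auto
      ultimately show False
        using least[of ?q] Suc.prems by simp
    qed
    then have "dim (insert (matpow M j *v r) ((\<lambda>i. matpow M i *v r) ` {..<j})) = Suc j"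
      using Suc unfolding krylov_def by (simp add: dim_insert)
    then show ?case
      unfolding krylov_def by (simp add: lessThan_Suc)
  qed (simp add: krylov_def)
  then show ?thesis by simp
qed

section \<open>Annihilating an invariant subspace\<close>

text \<open>
  The half of the rank-nullity theorem, relative to \<open>S\<close>, that is needed below: a basis of \<open>K\<close>
  extends to a basis of \<open>S\<close>, and only the added vectors contribute to the image.
\<close>

lemma dim_image_add_dim_kernel_le:
  fixes f :: "'a::euclidean_space \<Rightarrow> 'b::euclidean_space"
  assumes f: "linear f" and KS: "K \<subseteq> S" and zero: "\<And>x. x \<in> K \<Longrightarrow> f x = 0"
  shows "dim (f ` S) + dim K \<le> dim S"
proof -
  obtain C where C: "C \<subseteq> K" "independent C" "K \<subseteq> span C" "card C = dim K"
    using basis_exists by blast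
  obtain B where B: "C \<subseteq> B" "B \<subseteq> S" "independent B" "S \<subseteq> span B"
    using maximal_independent_subset_extend[of C S] C KS by (metis subset_trans)
  have fin: "finite B"
    using B(3) by (rule independent_imp_finite)
  have "f ` S \<subseteq> span (f ` B)"
    using B(4) linear_span_image[OF f] by blast
  also have "\<dots> \<subseteq> span (insert 0 (f ` (B - C)))"
    using C(1) zero by (intro span_mono) blast
  finally have "f ` S \<subseteq> span (f ` (B - C))"
    by simp
  then have "dim (f ` S) \<le> card (f ` (B - C))"
    using fin by (intro dim_le_card) auto
  also have "\<dots> \<le> card B - card C"
    using fin B(1) by (metis card_Diff_subset card_image_le finite_Diff finite_subset)
  finally have "dim (f ` S) + card C \<le> card B"
    using card_mono[OF fin B(1)] by simp
  then show ?thesis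
    using C(4) B dim_unique[of B S] by simp
qed

text \<open>
  Induction on the dimension. Let \<open>q\<close> be an annihilator of least degree of a nonzero vector
  \<open>v \<in> W\<close>. The cyclic subspace generated by \<open>v\<close> has dimension \<open>degree q\<close>, lies in \<open>W\<close>, and is
  killed by \<open>q(M)\<close>. Hence \<open>q(M) W\<close>, again invariant, has dimension at most \<open>dim W - degree q\<close>; if \<open>p\<close>
  annihilates it within the degree bound, then \<open>p q\<close> does so for \<open>W\<close>. Passing to the image
  \<open>q(M) W\<close> takes the place of passing to a quotient space.
\<close>

lemma annihilator_of_invariant_subspace:
  fixes M :: "real^'n^'n"
  assumes "subspace W" and "\<And>x. x \<in> W \<Longrightarrow> M *v x \<in> W"
  shows "\<exists>p. p \<noteq> 0 \<and> degree p \<le> dim W \<and> (\<forall>x\<in>W. poly_matrix p M *v x = 0)"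
  using assms
proof (induction "dim W" arbitrary: W rule: less_induct)
  case less
  show ?case
  proof (cases "W \<subseteq> {0}")
    case True
    then show ?thesis by (intro exI[of _ 1]) auto
  next
    case False
    then obtain v where v: "v \<in> W" "v \<noteq> 0" by auto
    obtain q where q: "q \<noteq> 0" "poly_matrix q M *v v = 0"
      and least: "\<And>p. p \<noteq> 0 \<Longrightarrow> poly_matrix p M *v v = 0 \<Longrightarrow> degree q \<le> degree p"
    proof -
      let ?P = "\<lambda>p. p \<noteq> 0 \<and> poly_matrix p M *v v = 0"
      obtain p0 where "?P p0"
        using ex_annihilating_poly[of M] by (metis matrix_vector_mult_0)
      then show ?thesis
        using that[of "arg_min degree ?P"] arg_min_natI[of ?P p0 degree] arg_min_nat_le[of ?P _ degree]
        by blast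
    qed
    \<comment> \<open>This makes the dimension drop strictly, as the induction requires.\<close>
    have "degree q \<noteq> 0"
    proof
      assume "degree q = 0"
      then obtain c where "q = [:c:]" by (rule degree_eq_zeroE)
      then show False
        using q v(2) by (simp add: poly_matrix_pCons scaleR_matrix_vector_assoc[symmetric])
    qed
    let ?f = "\<lambda>x. poly_matrix q M *v x"
    have "krylov (degree q) M v \<subseteq> W"
    proof -
      have "matpow M j *v v \<in> W" for j
        by (induction j) (use v less.prems(2) in \<open>auto simp flip: matrix_vector_mul_assoc\<close>)
      then show ?thesis
        unfolding krylov_def by (intro span_minimal less.prems(1)) auto
    qed
    moreover have "?f x = 0" if x: "x \<in> krylov (degree q) M v" for x
    proof -
      obtain p where "x = poly_matrix p M *v v"
        using x unfolding krylov_eq_polys by blast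
      then have "?f x = poly_matrix (p * q) M *v v"
        by (simp only: matrix_vector_mul_assoc mult.commute[of p q] poly_matrix_mult)
      then show ?thesis
        by (simp add: q(2) poly_matrix_mult flip: matrix_vector_mul_assoc)
    qed
    ultimately have "dim (?f ` W) + dim (krylov (degree q) M v) \<le> dim W"
      by (intro dim_image_add_dim_kernel_le matrix_vector_mul_linear)
    then have dim: "dim (?f ` W) + degree q \<le> dim W"
      using dim_krylov_eq_degree[of M v "degree q"] least by simp
    have "\<exists>p. p \<noteq> 0 \<and> degree p \<le> dim (?f ` W) \<and> (\<forall>x\<in>?f ` W. poly_matrix p M *v x = 0)"
    proof (rule less.hyps)
      show "dim (?f ` W) < dim W"
        using dim \<open>degree q \<noteq> 0\<close> by simp
      show "subspace (?f ` W)"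
        by (intro linear_subspace_image matrix_vector_mul_linear less.prems(1))
      show "M *v x \<in> ?f ` W" if "x \<in> ?f ` W" for x
        using that less.prems(2) poly_matrix_commute[of M q]
        by (auto simp: matrix_vector_mul_assoc) (metis image_eqI matrix_vector_mul_assoc)
    qed
    then obtain p where p: "p \<noteq> 0" "degree p \<le> dim (?f ` W)"
      "\<And>x. x \<in> W \<Longrightarrow> poly_matrix p M *v (?f x) = 0" by blast
    have "p * q \<noteq> 0"
      using p(1) q(1) by simp
    moreover have "degree (p * q) \<le> dim W"
      using degree_mult_le[of p q] p(2) dim by linarith
    moreover have "poly_matrix (p * q) M *v x = 0" if "x \<in> W" for x
      using p(3)[OF that] by (simp add: poly_matrix_mult matrix_vector_mul_assoc)
    ultimately show ?thesis by blast
  qed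
qed

section \<open>Perturbations of the identity of low rank\<close>

text \<open>
  The range of \<open>M - I\<close> is invariant under \<open>M\<close>, so a polynomial \<open>p\<close> whose degree is at most the
  rank vanishes on it; multiplying by \<open>x - 1\<close> first sends every vector into that range.
\<close>

lemma annihilating_poly_rank_shifted:
  fixes M :: "real^'n^'n"
  shows "\<exists>p. p \<noteq> 0 \<and> degree p \<le> rank (M - mat 1) + 1 \<and> poly_matrix p M = 0"
proof -
  let ?N = "M - mat 1" and ?W = "range (\<lambda>x. (M - mat 1) *v x)"
  have N: "poly_matrix [:-1, 1:] M = ?N"
    by (simp add: poly_matrix_pCons)
  have inv: "M *v x \<in> ?W" if "x \<in> ?W" for x
    using that poly_matrix_commute[of M "[:-1, 1:]"] unfolding N
    by (auto simp: matrix_vector_mul_assoc) (metis rangeI matrix_vector_mul_assoc)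
  have "\<exists>p. p \<noteq> 0 \<and> degree p \<le> dim ?W \<and> (\<forall>x\<in>?W. poly_matrix p M *v x = 0)"
    using inv by (intro annihilator_of_invariant_subspace linear_subspace_image
        matrix_vector_mul_linear subspace_UNIV)
  then obtain p where p: "p \<noteq> 0" "degree p \<le> rank ?N"
    "\<And>x. poly_matrix p M *v (?N *v x) = 0"
    unfolding rank_dim_range by blast
  have "poly_matrix (p * [:-1, 1:]) M = 0"
    using p(3) by (simp only: matrix_eq poly_matrix_mult N matrix_vector_mul_assoc matrix_vector_mult_0) simp
  moreover have "p * [:-1, 1:] \<noteq> 0"
    using p(1) by (metis mult_eq_0_iff pCons_eq_0_iff one_neq_zero)
  moreover have "degree (p * [:-1, 1:]) \<le> rank ?N + 1"
    using degree_mult_le[of p "[:-1, 1:]"] p(2) by simp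
  ultimately show ?thesis by blast
qed

section \<open>The preconditioned saddle point matrix\<close>

lemma rank_saddle_minus_rehss_le:
  fixes A :: "real^'n^'n" and B :: "real^'n^'m"
  shows "rank (saddle_matrix A B - rehss \<alpha> A B) \<le> CARD('m)"
proof -
  let ?D = "saddle_matrix A B - rehss \<alpha> A B"
  \<comment> \<open>The two matrices share their first block column.\<close>
  have col: "column j ?D \<in> insert 0 (range (\<lambda>d. column (Inr d) ?D))" for j
    by (cases j)
      (auto simp: column_def vec_eq_iff saddle_matrix_def rehss_def block_matrix_def split: sum.splits)
  have "columns ?D \<subseteq> insert 0 (range (\<lambda>d. column (Inr d) ?D))"
    unfolding columns_def using col by blast
  also have "\<dots> \<subseteq> span (range (\<lambda>d. column (Inr d) ?D))"
    by (auto intro: span_base span_zero)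
  finally have "dim (columns ?D) \<le> card (range (\<lambda>d. column (Inr d) ?D))"
    by (rule dim_le_card) simp
  also have "\<dots> \<le> CARD('m)"
    by (rule card_image_le) simp
  finally show ?thesis
    by (simp add: column_rank_def)
qed

theorem theorem3:
  fixes A :: "real^'n^'n" and B :: "real^'n^'m"
    and \<alpha> :: real and b :: "real^('n + 'm)"
  assumes "symmetric_positive_definite A"
    and "rank B = CARD('m)" and "CARD('m) < CARD('n)"
    and "\<alpha> > 0"
  shows "degree (minimal_poly (matrix_inv (rehss \<alpha> A B) ** saddle_matrix A B)) \<le> CARD('m) + 1 \<and>
         dim (krylov CARD('n) (matrix_inv (rehss \<alpha> A B) ** saddle_matrix A B) b) \<le> CARD('m) + 1"
proof -
  let ?P = "rehss \<alpha> A B" and ?S = "saddle_matrix A B"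
  let ?T = "matrix_inv ?P ** ?S"
  have "matrix_inv ?P ** ?P = mat 1"
    using invertible_rehss[OF assms(1,4)] by (rule matrix_inv_left)
  then have "?T - mat 1 = matrix_inv ?P ** (?S - ?P)"
    by (simp add: matrix_eq matrix_vector_mult_diff_rdistrib matrix_vector_mult_diff_distrib
        flip: matrix_vector_mul_assoc)
  then have "rank (?T - mat 1) \<le> CARD('m)"
    using rank_mul_le_right[of "matrix_inv ?P" "?S - ?P"] rank_saddle_minus_rehss_le[of A B \<alpha>] by simp
  then obtain p where p: "p \<noteq> 0" "degree p \<le> CARD('m) + 1" "poly_matrix p ?T = 0"
    using annihilating_poly_rank_shifted[of ?T] by fastforce
  have "degree (minimal_poly ?T) \<le> degree p"
    using minimal_poly_is_minimal[of ?T] p(1,3) unfolding is_minimal_poly_def by blast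
  moreover have "dim (krylov CARD('n) ?T b) \<le> degree p"
    using dim_subset[OF krylov_subset_of_annihilator[of p ?T b "CARD('n)"]] p(1,3)
      dim_krylov_le[of "degree p" ?T b] by fastforce
  ultimately show ?thesis
    using p(2) by linarith
qed

end
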